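(* Let $\xi\in[0,1[$ and $\eta\in\mathbb R$, and let $p,q\colon[0,1[\to\mathbb R$ be continuous functions that are integrable on $[0,1[$, i.e. $\int_0^1|p(x)|\,dx<\infty$ and $\int_0^1|q(x)|\,dx<\infty$. Then there exists $n^*\in\mathbb N$ such that for every $n\ge n^*$ the discretized integral equation $$\overline{y}_n(x)=\eta+S_{2^n}\left(\int_{\xi}^{\cdot}\big(S_{2^n}q(t)-S_{2^n}p(t)\,\overline{y}_n(t)\big)\,dt\right)(x),\qquad x\in[0,1[,$$ has a unique solution $\overline{y}_n$ among the Walsh polynomials of the form $\overline{y}_n=\sum_{k=0}^{2^n-1}c_k\omega_k$ with real coefficients $c_0,\dots,c_{2^n-1}$.
   Context: Notation: $[0,1[$ is the half-open interval $\{x: 0\le x<1\}$. Each $x\in[0,1[$ is written as $x=\sum_{k=0}^\infty x_k2^{-(k+1)}$ with $x_k\in\{0,1\}$, where for dyadic rationals the expansion terminating in zeros is chosen. Each $n\in\mathbb N$ is written as $n=\sum_{k=0}^\infty n_k2^k$ with $n_k\in\{0,1\}$. The Rademacher functions are $r_k(x)=(-1)^{x_k}$, and the Walsh functions in the Paley enumeration are $\omega_n(x)=\prod_{k=0}^\infty r_k(x)^{n_k}$ ($x\in[0,1[$, $n\in\mathbb N=\{0,1,2,\dots\}$). For integrable $f$ on $[0,1[$, the Walsh-Fourier coefficients are $\widehat f_k=\int_0^1 f(x)\omega_k(x)\,dx$ and the partial sums are $S_mf(x)=\sum_{k=0}^{m-1}\widehat f_k\,\omega_k(x)$. Equivalently,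 $S_{2^n}f(x)=2^n\int_{I_n(x)}f(y)\,dy$, where $I_n(x)$ is the dyadic interval $[\frac{i-1}{2^n},\frac{i}{2^n}[$ ($1\le i\le 2^n$) containing $x$. In the equation, $S_{2^n}$ is applied to the function $s\mapsto\int_\xi^s(\cdots)\,dt$ on $[0,1[$, with the usual oriented-integral convention $\int_\xi^s=-\int_s^\xi$ when $s<\xi$. The equation is the discretization of the integral form of the Cauchy problem $y'+p(x)y=q(x)$, $y(\xi)=\eta$, on $[0,1[$. *)

theory Defs
  imports "HOL-Analysis.Analysis"
begin

definition dyadic_rational :: "real \<Rightarrow> bool" where
  "dyadic_rational x \<longleftrightarrow> (\<exists>(m::int) (N::nat). x = of_int m / 2 ^ N)"

definition binary_expansion :: "real \<Rightarrow> (nat \<Rightarrow> nat) \<Rightarrow> bool" where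
  "binary_expansion x d \<longleftrightarrow>
     (\<forall>k. d k \<in> {0, 1}) \<and>
     (\<lambda>k. real (d k) / 2 ^ (k + 1)) sums x \<and>
     (dyadic_rational x \<longrightarrow> (\<forall>\<^sub>F k in sequentially. d k = 0))"

definition binary_digit :: "real \<Rightarrow> nat \<Rightarrow> nat" where
  "binary_digit x = (THE d. binary_expansion x d)"

definition rademacher :: "nat \<Rightarrow> real \<Rightarrow> real" where
  "rademacher k x = (- 1) ^ binary_digit x k"

text \<open>The exponent is the binary digit \<open>n\<^sub>k\<close> of \<open>n\<close>; all but finitely many factors are 1.\<close>

definition walsh :: "nat \<Rightarrow> real \<Rightarrow> real" where
  "walsh n x = (\<Prod>k. rademacher k x ^ of_bool (bit n k))"

definition walsh_coeff :: "(real \<Rightarrow> real) \<Rightarrow> nat \<Rightarrow> real" where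
  "walsh_coeff f k = (LBINT x:{0..<1}. f x * walsh k x)"

definition walsh_partial_sum :: "nat \<Rightarrow> (real \<Rightarrow> real) \<Rightarrow> real \<Rightarrow> real" where
  "walsh_partial_sum m f x = (\<Sum>k<m. walsh_coeff f k * walsh k x)"

text \<open>Walsh polynomials are functions on \<open>[0,1[\<close> only. They are made \<open>undefined\<close>
  outside, so that equality in HOL is equality on \<open>[0,1[\<close>.\<close>

definition walsh_polynomials :: "nat \<Rightarrow> (real \<Rightarrow> real) set" where
  "walsh_polynomials m =
     {y. \<exists>c :: nat \<Rightarrow> real. y = (\<lambda>x\<in>{0..<1}. \<Sum>k<m. c k * walsh k x)}"

text \<open>The integral from \<open>\<xi>\<close> to \<open>s\<close> is the oriented interval integral, hence changes sign for
  \<open>s < \<xi>\<close>.\<close>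

definition discretized_solution ::
  "real \<Rightarrow> real \<Rightarrow> (real \<Rightarrow> real) \<Rightarrow> (real \<Rightarrow> real) \<Rightarrow> nat \<Rightarrow> (real \<Rightarrow> real) \<Rightarrow> bool" where
  "discretized_solution \<xi> \<eta> p q n y \<longleftrightarrow>
     (\<forall>x\<in>{0..<1}. y x = \<eta> + walsh_partial_sum (2 ^ n)
        (\<lambda>s. LBINT t=\<xi>..s.
           walsh_partial_sum (2 ^ n) q t - walsh_partial_sum (2 ^ n) p t * y t) x)"


text \<open>The expansion exists and is unique, so \<open>binary_digit\<close> is well defined; explicitly:\<close>

lemma binary_expansion_floor:
  assumes x: "0 \<le> x" "x < 1"
  shows "binary_expansion x (\<lambda>k. nat (\<lfloor>2 ^ (k + 1) * x\<rfloor> mod 2))"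
proof -
  let ?d = "\<lambda>k. nat (\<lfloor>2 ^ (k + 1) * x\<rfloor> mod 2)"
  have fl: "\<lfloor>2 * y\<rfloor> = 2 * \<lfloor>y\<rfloor> + \<lfloor>2 * y\<rfloor> mod 2" for y :: real
  proof -
    have "\<lfloor>2 * y\<rfloor> div 2 = \<lfloor>y\<rfloor>" by linarith
    thus ?thesis by presburger
  qed
  have ps: "(\<Sum>k<n. real (?d k) / 2 ^ (k + 1)) = of_int \<lfloor>2 ^ n * x\<rfloor> / 2 ^ n" for n
  proof (induction n)
    case 0
    have "\<lfloor>x\<rfloor> = 0" using x by linarith
    then show ?case by simp
  next
    case (Suc n)
    have "real (?d n) = of_int (\<lfloor>2 ^ (n + 1) * x\<rfloor> mod 2)" by simp
    also have "\<dots> = of_int (\<lfloor>2 ^ Suc n * x\<rfloor>) - 2 * of_int \<lfloor>2 ^ n * x\<rfloor>"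
      using fl[of "2 ^ n * x"] by (simp add: mult.assoc)
    finally have d: "real (?d n) = of_int (\<lfloor>2 ^ Suc n * x\<rfloor>) - 2 * of_int \<lfloor>2 ^ n * x\<rfloor>" .
    show ?case unfolding sum.lessThan_Suc Suc.IH d by (simp add: field_simps)
  qed
  have "(\<lambda>n. of_int \<lfloor>2 ^ n * x\<rfloor> / 2 ^ n) \<longlonglongrightarrow> x"
  proof (rule tendsto_sandwich)
    show "\<forall>\<^sub>F n in sequentially. x - (1 / 2) ^ n \<le> of_int \<lfloor>2 ^ n * x\<rfloor> / 2 ^ n"
    proof (intro always_eventually allI)
      fix n :: nat
      have "2 ^ n * x - 1 \<le> of_int \<lfloor>2 ^ n * x\<rfloor>" by linarith
      hence "(2 ^ n * x - 1) / 2 ^ n \<le> of_int \<lfloor>2 ^ n * x\<rfloor> / 2 ^ n"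
        by (rule divide_right_mono) simp
      thus "x - (1 / 2) ^ n \<le> of_int \<lfloor>2 ^ n * x\<rfloor> / 2 ^ n"
        by (simp add: diff_divide_distrib power_divide)
    qed
    show "\<forall>\<^sub>F n in sequentially. of_int \<lfloor>2 ^ n * x\<rfloor> / 2 ^ n \<le> x"
      by (intro always_eventually allI) (simp add: field_simps)
    show "(\<lambda>n. x - (1 / 2) ^ n) \<longlonglongrightarrow> x"
      using tendsto_diff[OF tendsto_const[of x] LIMSEQ_power_zero[of "1 / 2 :: real"]] by simp
  qed simp
  hence "(\<lambda>k. real (?d k) / 2 ^ (k + 1)) sums x" unfolding sums_def ps .
  moreover have "\<forall>\<^sub>F k in sequentially. ?d k = 0" if dy: "dyadic_rational x"
  proof -
    obtain m N where m: "x = of_int m / 2 ^ N" using dy unfolding dyadic_rational_def by blast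
    have "?d k = 0" if "k \<ge> N" for k
    proof -
      have "(2::real) ^ (k + 1) = 2 ^ N * (2 * 2 ^ (k - N))"
        using that by (simp flip: power_add power_Suc)
      hence "2 ^ (k + 1) * x = of_int (2 * (2 ^ (k - N) * m))" unfolding m by simp
      hence "\<lfloor>2 ^ (k + 1) * x\<rfloor> = 2 * (2 ^ (k - N) * m)" by (metis floor_of_int)
      thus ?thesis by simp
    qed
    thus ?thesis unfolding eventually_sequentially by blast
  qed
  moreover have "?d k \<in> {0, 1}" for k by auto
  ultimately show ?thesis unfolding binary_expansion_def by blast
qed

lemma binary_expansion_unique:
  assumes e: "binary_expansion x d"
  shows "d k = nat (\<lfloor>2 ^ (k + 1) * x\<rfloor> mod 2)"
proof -
  have d01: "\<And>k. d k = 0 \<or> d k = 1" and s: "(\<lambda>k. real (d k) / 2 ^ (k + 1)) sums x"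
    and ev: "dyadic_rational x \<Longrightarrow> \<forall>\<^sub>F k in sequentially. d k = 0"
    using e unfolding binary_expansion_def by auto
  define D where "D n = (\<Sum>k<n. 2 ^ (n - Suc k) * int (d k))" for n
  have D_Suc: "D (Suc n) = 2 * D n + int (d n)" for n
  proof -
    have "(\<Sum>k<n. 2 ^ (Suc n - Suc k) * int (d k)) = 2 * D n"
      unfolding D_def sum_distrib_left
      by (intro sum.cong refl) (simp add: Suc_diff_le flip: power_Suc mult.assoc, metis Suc_diff_Suc)
    thus ?thesis unfolding D_def by simp
  qed
  have psum: "(\<Sum>k<n. real (d k) / 2 ^ (k + 1)) = of_int (D n) / 2 ^ n" for n
    by (induction n) (simp_all add: D_Suc field_simps, simp add: D_def)
  have geo: "(\<lambda>k. 1 / 2 ^ (k + n + 1)) sums (1 / 2 ^ n :: real)" for n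
    using sums_mult[OF power_half_series, of "1 / 2 ^ n"]
    by (simp add: power_add power_divide field_simps)
  have fl: "\<lfloor>2 ^ n * x\<rfloor> = D n" for n
  proof -
    have t: "(\<lambda>k. real (d (k + n)) / 2 ^ (k + n + 1)) sums (x - of_int (D n) / 2 ^ n)"
      using s sums_iff_shift[of "\<lambda>k. real (d k) / 2 ^ (k + 1)" n] psum[of n] by simp
    have ge: "0 \<le> x - of_int (D n) / 2 ^ n"
      by (rule sums_le[OF _ sums_zero t]) simp
    have "x - of_int (D n) / 2 ^ n < 1 / 2 ^ n"
    proof (rule ccontr)
      assume n: "\<not> ?thesis"
      have df: "(\<lambda>k. 1 / 2 ^ (k + n + 1) - real (d (k + n)) / 2 ^ (k + n + 1)) sums
                 (1 / 2 ^ n - (x - of_int (D n) / 2 ^ n))"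
        by (rule sums_diff[OF geo t])
      have nn: "0 \<le> 1 / 2 ^ (k + n + 1) - real (d (k + n)) / 2 ^ (k + n + 1)" for k
        using d01[of "k + n"] by auto
      have "0 \<le> 1 / 2 ^ n - (x - of_int (D n) / 2 ^ n)"
        by (rule sums_le[OF nn sums_zero df])
      hence z: "1 / 2 ^ n - (x - of_int (D n) / 2 ^ n) = 0" using n by linarith
      have "1 / 2 ^ (k + n + 1) - real (d (k + n)) / 2 ^ (k + n + 1) = 0" for k
        using suminf_eq_zero_iff[OF sums_summable[OF df] nn] sums_unique[OF df] z by simp
      hence one: "d (k + n) = 1" for k by (simp add: field_simps)
      have "x = of_int (D n + 1) / 2 ^ n" using z by (simp add: field_simps)
      hence "dyadic_rational x" unfolding dyadic_rational_def by blast
      then obtain M where "\<And>k. k \<ge> M \<Longrightarrow> d k = 0"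
        using ev unfolding eventually_sequentially by blast
      thus False using one[of M] by simp
    qed
    hence "x < (of_int (D n) + 1) / 2 ^ n" by (simp add: add_divide_distrib)
    hence "2 ^ n * x < of_int (D n) + 1" by (simp add: pos_less_divide_eq mult.commute)
    moreover have "of_int (D n) \<le> 2 ^ n * x" using ge by (simp add: pos_divide_le_eq mult.commute)
    ultimately show ?thesis by (simp add: floor_eq_iff)
  qed
  have "\<lfloor>2 ^ (k + 1) * x\<rfloor> mod 2 = int (d k)"
    using d01[of k] unfolding fl Suc_eq_plus1[symmetric] D_Suc by auto
  thus ?thesis by simp
qed

lemma binary_digit_eq:
  assumes "0 \<le> x" "x < 1"
  shows "binary_digit x k = nat (\<lfloor>2 ^ (k + 1) * x\<rfloor> mod 2)"
proof -
  have "binary_digit x = (\<lambda>k. nat (\<lfloor>2 ^ (k + 1) * x\<rfloor> mod 2))"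
    unfolding binary_digit_def
  proof (rule the_equality)
    show "binary_expansion x (\<lambda>k. nat (\<lfloor>2 ^ (k + 1) * x\<rfloor> mod 2))"
      by (rule binary_expansion_floor[OF assms])
    show "d = (\<lambda>k. nat (\<lfloor>2 ^ (k + 1) * x\<rfloor> mod 2))" if "binary_expansion x d" for d
      using binary_expansion_unique[OF that] by blast
  qed
  thus ?thesis by simp
qed

lemma walsh_eq_finite_prod: "walsh n x = (\<Prod>k | bit n k. rademacher k x)"
proof -
  have "k < n" if "bit n k" for k
  proof (rule ccontr)
    assume "\<not> k < n"
    hence "n < 2 ^ k" using less_exp[of k] by linarith
    thus False using that by (simp add: bit_iff_odd)
  qed
  hence "finite {k. bit n k}" by (auto intro: finite_subset[of _ "{..<n}"])
  hence "walsh n x = (\<Prod>k\<in>{k. bit n k}. rademacher k x ^ of_bool (bit n k))"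
    unfolding walsh_def by (rule prodinf_finite) auto
  thus ?thesis by simp
qed

end

theory Submission
  imports Defs
begin

text \<open>The operator \<open>S\<close> of order \<open>2 ^ n\<close> replaces a function by its averages over the \<open>2 ^ n\<close> dyadic
  cells of length \<open>h = 2 ^ - n\<close> (lemma \<open>walsh_partial_sum_eq_average\<close>), and the Walsh polynomials of
  that order are exactly the functions that are constant on the cells (lemma
  \<open>walsh_polynomials_eq_step_functions\<close>). Both facts come from the Dirichlet kernel of order
  \<open>2 ^ n\<close>, which vanishes unless its two arguments lie in one cell. The discretized equation is
  therefore a linear system for the values \<open>Y i\<close> of the unknown step function.

  Let \<open>P i\<close>, \<open>Q i\<close> be the cell averages of \<open>p\<close>, \<open>q\<close> and \<open>g i = Q i - P i * Y i\<close>. The function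
  \<open>F s\<close>, the integral of this step function from \<open>\<xi>\<close> to \<open>s\<close>, is continuous and affine with slope
  \<open>g i\<close> on cell \<open>i\<close>, so its average over a cell is its value at the midpoint. The averages over two
  neighbouring cells thus differ by \<open>h / 2 * (g i + g (i + 1))\<close>, and the average over the cell \<open>m\<close> of
  \<open>\<xi>\<close> is \<open>\<delta> * g m\<close>, where \<open>\<delta>\<close> is the signed distance from \<open>\<xi>\<close> to the midpoint, because
  \<open>F \<xi> = 0\<close>. Since a finite sequence is determined by one entry and its increments, the system says
  (lemma \<open>discretized_solution_step_iff\<close>)

    \<open>(1 + \<delta> * P m) * Y m = \<eta> + \<delta> * Q m\<close>,

    \<open>(1 + h / 2 * P (i + 1)) * Y (i + 1) = (1 - h / 2 * P i) * Y i + h / 2 * (Q i + Q (i + 1))\<close>.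

  Here \<open>h * P i\<close> is the integral of \<open>p\<close> over cell \<open>i\<close>. The indefinite integral of \<open>p\<close> is uniformly
  continuous, so for large \<open>n\<close> all these integrals are smaller than 2 in modulus (lemma
  \<open>integral_dyadic_interval_uniformly_small\<close>). As \<open>\<bar>\<delta>\<bar> \<le> h / 2\<close>, none of the coefficients
  \<open>1 + \<delta> * P m\<close>, \<open>1 + h / 2 * P i\<close>, \<open>1 - h / 2 * P i\<close> vanishes. The first equation then fixes \<open>Y m\<close>,
  and the recurrence can be solved uniquely in both directions from there.\<close>

section \<open>Dyadic cells\<close>

definition dyadic_index :: "nat \<Rightarrow> real \<Rightarrow> nat" where
  "dyadic_index n x = nat \<lfloor>2 ^ n * x\<rfloor>"

definition dyadic_interval :: "nat \<Rightarrow> nat \<Rightarrow> real set" where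
  "dyadic_interval n i = {real i / 2 ^ n ..< real (Suc i) / 2 ^ n}"

lemma dyadic_index_eq_iff:
  assumes "0 \<le> x"
  shows "dyadic_index n x = i \<longleftrightarrow> x \<in> dyadic_interval n i"
proof -
  have "dyadic_index n x = i \<longleftrightarrow> \<lfloor>2 ^ n * x\<rfloor> = int i"
    using assms unfolding dyadic_index_def by (auto simp: nat_eq_iff)
  also have "\<dots> \<longleftrightarrow> x \<in> dyadic_interval n i"
    unfolding dyadic_interval_def floor_eq_iff by (auto simp: field_simps)
  finally show ?thesis .
qed

lemma dyadic_index_less:
  assumes "x \<in> {0..<1}"
  shows "dyadic_index n x < 2 ^ n"
proof -
  have "\<lfloor>2 ^ n * x\<rfloor> < 2 ^ n"
    using assms by (simp add: floor_less_iff)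
  then show ?thesis
    unfolding dyadic_index_def by (simp add: nat_less_iff)
qed

lemma dyadic_interval_subset:
  assumes "i < 2 ^ n"
  shows "dyadic_interval n i \<subseteq> {0..<1}"
proof -
  have "real (Suc i) \<le> 2 ^ n"
    using assms by (metis Suc_leI of_nat_le_iff of_nat_numeral of_nat_power)
  then have "real (Suc i) / 2 ^ n \<le> 1"
    by simp
  then show ?thesis
    unfolding dyadic_interval_def
    by (intro ivl_subset[THEN iffD2] disjI2 conjI) simp_all
qed

lemma dyadic_index_eqI:
  assumes "i < 2 ^ n" "x \<in> dyadic_interval n i"
  shows "dyadic_index n x = i"
  using assms dyadic_interval_subset[of i n] dyadic_index_eq_iff[of x n i] by auto

lemma left_endpoint_in_dyadic_interval: "real i / 2 ^ n \<in> dyadic_interval n i"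
  by (simp add: dyadic_interval_def divide_strict_right_mono)

lemma left_endpoint_in_unit_interval:
  assumes "i < 2 ^ n"
  shows "real i / 2 ^ n \<in> {0..<1}"
  using dyadic_interval_subset[OF assms] left_endpoint_in_dyadic_interval by blast

lemma dyadic_index_left_endpoint:
  assumes "i < 2 ^ n"
  shows "dyadic_index n (real i / 2 ^ n) = i"
  by (rule dyadic_index_eqI[OF assms left_endpoint_in_dyadic_interval])

text \<open>Primitives of step functions are affine on closed cells, so membership is needed in this closed form.\<close>

lemma in_own_closed_cell:
  assumes "x \<in> {0..<1}"
  shows "x \<in> {real (dyadic_index n x) / 2 ^ n..real (Suc (dyadic_index n x)) / 2 ^ n}"
proof -
  have "x \<in> dyadic_interval n (dyadic_index n x)"
    using dyadic_index_eq_iff[of x n "dyadic_index n x"] assms by simp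
  then show ?thesis
    unfolding dyadic_interval_def by auto
qed

text \<open>Passing to the next level halves each cell, and the next binary digit says in which half the
  point lies. This ties the digits that define the Rademacher functions to the cells.\<close>

lemma dyadic_index_Suc:
  assumes "x \<in> {0..<1}"
  shows "dyadic_index (Suc n) x = 2 * dyadic_index n x + binary_digit x n"
    and "binary_digit x n \<in> {0, 1}"
proof -
  have d: "binary_digit x n = nat (\<lfloor>2 * (2 ^ n * x)\<rfloor> mod 2)"
    using binary_digit_eq[of x n] assms by (simp add: mult.assoc)
  have "\<lfloor>2 * (2 ^ n * x)\<rfloor> div 2 = \<lfloor>2 ^ n * x\<rfloor>"
    by linarith
  then have "\<lfloor>2 * (2 ^ n * x)\<rfloor> = 2 * \<lfloor>2 ^ n * x\<rfloor> + \<lfloor>2 * (2 ^ n * x)\<rfloor> mod 2"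
    by presburger
  moreover have "0 \<le> \<lfloor>2 ^ n * x\<rfloor>"
    using assms by simp
  moreover have "nat u = 2 * nat a + nat (u mod 2)" if "u = 2 * a + u mod 2" "0 \<le> a" for u a :: int
    using that pos_mod_sign[of 2 u] by linarith
  ultimately show "dyadic_index (Suc n) x = 2 * dyadic_index n x + binary_digit x n"
    unfolding dyadic_index_def d power_Suc mult.assoc by blast
  show "binary_digit x n \<in> {0, 1}"
    unfolding d by auto
qed

section \<open>Walsh functions on dyadic cells\<close>

text \<open>In the Paley enumeration, the functions with index from \<open>2 ^ n\<close> to \<open>2 ^ (n + 1) - 1\<close> are all
  earlier ones times a single new Rademacher function. This drives the two inductions below.\<close>

lemma walsh_add_power:
  assumes "k < 2 ^ n"
  shows "walsh (k + 2 ^ n) x = walsh k x * rademacher n x"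
proof -
  have k: "\<not> bit k j" if "j \<ge> n" for j
  proof -
    have "k < 2 ^ j"
      using assms that by (meson less_le_trans one_le_numeral power_increasing)
    then show ?thesis
      by (simp add: bit_iff_odd)
  qed
  then have "k + 2 ^ n = set_bit n k"
    by (simp add: set_bit_eq)
  then have "{j. bit (k + 2 ^ n) j} = insert n {j. bit k j}"
    by (auto simp: bit_simps)
  moreover have "finite {j. bit k j}"
    by (rule finite_subset[of _ "{..<n}"]) (use k in \<open>auto simp: not_le[symmetric]\<close>)
  ultimately show ?thesis
    unfolding walsh_eq_finite_prod using k[of n] by (simp add: mult.commute)
qed

lemma walsh_cong_dyadic_index:
  assumes "x \<in> {0..<1}" "t \<in> {0..<1}" "dyadic_index n x = dyadic_index n t" "k < 2 ^ n"
  shows "walsh k x = walsh k t"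
  using assms(3,4)
proof (induction n arbitrary: k)
  case 0
  then show ?case
    by (simp add: walsh_eq_finite_prod)
next
  case (Suc n)
  have "2 * dyadic_index n x + binary_digit x n = 2 * dyadic_index n t + binary_digit t n"
    using Suc.prems(1) dyadic_index_Suc(1) assms(1,2) by simp
  moreover have "binary_digit x n \<le> 1" "binary_digit t n \<le> 1"
    using dyadic_index_Suc(2)[OF assms(1), of n] dyadic_index_Suc(2)[OF assms(2), of n] by auto
  ultimately have same: "dyadic_index n x = dyadic_index n t" "binary_digit x n = binary_digit t n"
    by presburger+
  show ?case
  proof (cases "k < 2 ^ n")
    case True
    then show ?thesis
      using Suc.IH same by blast
  next
    case False
    then obtain j where "k = j + 2 ^ n" "j < 2 ^ n"
      using Suc.prems(2) by (metis add.commute le_add_diff_inverse mult_2 nat_add_left_cancel_less not_less power_Suc)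
    then show ?thesis
      using Suc.IH[of j] same by (simp add: walsh_add_power rademacher_def)
  qed
qed

lemma walsh_at_left_endpoint:
  assumes "x \<in> {0..<1}" "k < 2 ^ n"
  shows "walsh k (real (dyadic_index n x) / 2 ^ n) = walsh k x"
proof (rule walsh_cong_dyadic_index[OF _ assms(1) _ assms(2)])
  have i: "dyadic_index n x < 2 ^ n"
    by (rule dyadic_index_less[OF assms(1)])
  show "real (dyadic_index n x) / 2 ^ n \<in> {0..<1}"
    by (rule left_endpoint_in_unit_interval[OF i])
  show "dyadic_index n (real (dyadic_index n x) / 2 ^ n) = dyadic_index n x"
    by (rule dyadic_index_left_endpoint[OF i])
qed

text \<open>Each step from \<open>n\<close> to \<open>n + 1\<close> multiplies the kernel by \<open>1 + r\<^sub>n(x) r\<^sub>n(t)\<close>, which is 2 if the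
  \<open>n\<close>-th digits agree and 0 otherwise. Hence the kernel survives only where the first \<open>n\<close> digits
  agree, that is, where \<open>x\<close> and \<open>t\<close> share a cell.\<close>

lemma walsh_dirichlet_kernel:
  assumes "x \<in> {0..<1}" "t \<in> {0..<1}"
  shows "(\<Sum>k<2 ^ n. walsh k x * walsh k t) = (if dyadic_index n x = dyadic_index n t then 2 ^ n else 0)"
proof (induction n)
  case 0
  have "dyadic_index 0 x = 0" "dyadic_index 0 t = 0"
    using dyadic_index_less[of _ 0] assms by auto
  moreover have "walsh 0 s = 1" for s
    by (simp add: walsh_eq_finite_prod)
  ultimately show ?case
    by simp
next
  case (Suc n)
  have "(\<Sum>k<2 ^ Suc n. walsh k x * walsh k t)
      = (\<Sum>k<2 ^ n. walsh k x * walsh k t) + (\<Sum>k<2 ^ n. walsh (k + 2 ^ n) x * walsh (k + 2 ^ n) t)"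
    using sum.atLeastLessThan_concat[of 0 "2 ^ n" "2 ^ n + 2 ^ n" "\<lambda>k. walsh k x * walsh k t"]
      sum.shift_bounds_nat_ivl[of "\<lambda>k. walsh k x * walsh k t" 0 "2 ^ n" "2 ^ n"]
    by (simp add: lessThan_atLeast0 mult_2)
  also have "(\<Sum>k<2 ^ n. walsh (k + 2 ^ n) x * walsh (k + 2 ^ n) t)
      = (\<Sum>k<2 ^ n. walsh k x * walsh k t) * (rademacher n x * rademacher n t)"
    unfolding sum_distrib_right by (rule sum.cong) (auto simp: walsh_add_power)
  finally have *: "(\<Sum>k<2 ^ Suc n. walsh k x * walsh k t)
      = (\<Sum>k<2 ^ n. walsh k x * walsh k t) * (1 + rademacher n x * rademacher n t)"
    by (simp add: algebra_simps)
  have d: "binary_digit x n = 0 \<or> binary_digit x n = 1" "binary_digit t n = 0 \<or> binary_digit t n = 1"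
    using dyadic_index_Suc(2)[OF assms(1), of n] dyadic_index_Suc(2)[OF assms(2), of n] by auto
  \<comment> \<open>Two doubled indices plus digits can agree only if the digits do, by parity.\<close>
  have ne: "2 * a \<noteq> Suc (2 * b)" "Suc (2 * b) \<noteq> 2 * a" for a b :: nat
    by presburger+
  show ?case
    unfolding * Suc.IH dyadic_index_Suc(1)[OF assms(1)] dyadic_index_Suc(1)[OF assms(2)] rademacher_def
    using d ne by auto
qed

text \<open>Walsh functions of index below \<open>2 ^ n\<close> are constant on cells, which gives one inclusion.
  For the other, up to the factor \<open>2 ^ n\<close> the Dirichlet kernel with one argument fixed in a cell is
  the indicator of that cell; so indicators of cells, and their combinations, are Walsh polynomials.\<close>

lemma walsh_polynomials_eq_step_functions:
  "y \<in> walsh_polynomials (2 ^ n) \<longleftrightarrow> (\<exists>Y. y = (\<lambda>x\<in>{0..<1}. Y (dyadic_index n x)))"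
proof
  assume "y \<in> walsh_polynomials (2 ^ n)"
  then obtain c where y: "y = (\<lambda>x\<in>{0..<1}. \<Sum>k<2 ^ n. c k * walsh k x)"
    unfolding walsh_polynomials_def by blast
  show "\<exists>Y. y = (\<lambda>x\<in>{0..<1}. Y (dyadic_index n x))"
    unfolding y
    by (intro exI[of _ "\<lambda>i. \<Sum>k<2 ^ n. c k * walsh k (real i / 2 ^ n)"] restrict_ext sum.cong refl)
       (simp add: walsh_at_left_endpoint)
next
  assume "\<exists>Y. y = (\<lambda>x\<in>{0..<1}. Y (dyadic_index n x))"
  then obtain Y where y: "y = (\<lambda>x\<in>{0..<1}. Y (dyadic_index n x))"
    by blast
  \<comment> \<open>These are the Walsh coefficients of the step function, with the integral over each cell evaluated.\<close>
  define c where "c k = (\<Sum>i<2 ^ n. Y i / 2 ^ n * walsh k (real i / 2 ^ n))" for k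
  have "Y (dyadic_index n x) = (\<Sum>k<2 ^ n. c k * walsh k x)" if x: "x \<in> {0..<1}" for x
  proof -
    have "(\<Sum>k<2 ^ n. c k * walsh k x)
        = (\<Sum>i<2 ^ n. Y i / 2 ^ n * (\<Sum>k<2 ^ n. walsh k x * walsh k (real i / 2 ^ n)))"
      unfolding c_def sum_distrib_left sum_distrib_right
      by (subst sum.swap) (simp add: mult_ac)
    also have "\<dots> = (\<Sum>i<2 ^ n. if i = dyadic_index n x then Y i else 0)"
    proof (rule sum.cong[OF refl])
      fix i :: nat assume "i \<in> {..<2 ^ n}"
      then have i: "i < 2 ^ n" by simp
      have "real i / 2 ^ n \<in> {0..<1}"
        by (rule left_endpoint_in_unit_interval[OF i])
      then show "Y i / 2 ^ n * (\<Sum>k<2 ^ n. walsh k x * walsh k (real i / 2 ^ n))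
          = (if i = dyadic_index n x then Y i else 0)"
        using walsh_dirichlet_kernel[OF x] dyadic_index_left_endpoint[OF i]
        by auto
    qed
    also have "\<dots> = Y (dyadic_index n x)"
      using dyadic_index_less[OF x] by simp
    finally show ?thesis ..
  qed
  then show "y \<in> walsh_polynomials (2 ^ n)"
    unfolding walsh_polynomials_def y by (auto intro!: exI[of _ c] restrict_ext)
qed

section \<open>Partial sums as averages over cells\<close>

text \<open>A step function takes finitely many values, so it is bounded; the sum of their moduli is a bound.
  With \<open>f = 1\<close> or \<open>f\<close> the identity this yields the integrability of step functions and of
  piecewise affine functions, and with \<open>u\<close> the values of a Walsh function that of \<open>f\<close> times it.\<close>

lemma set_integrable_mult_step:
  assumes "set_integrable lborel {0..<1} f"
  shows "set_integrable lborel {0..<1} (\<lambda>x. f x * u (dyadic_index n x) :: real)"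
proof -
  have "(\<lambda>x. u (dyadic_index n x)) \<in> borel_measurable lborel"
    unfolding dyadic_index_def by measurable
  then have meas: "set_borel_measurable lborel {0..<1} (\<lambda>x. f x * u (dyadic_index n x))"
    using assms unfolding set_borel_measurable_def set_integrable_def
    by (simp add: mult.assoc[symmetric] borel_measurable_times)
  have dom: "set_integrable lborel {0..<1} (\<lambda>x. f x * (\<Sum>i<2 ^ n. \<bar>u i\<bar>))"
    using assms by simp
  have le: "norm (f x * u (dyadic_index n x)) \<le> norm (f x * (\<Sum>i<2 ^ n. \<bar>u i\<bar>))"
    if "x \<in> {0..<1}" for x
  proof -
    have "\<bar>u (dyadic_index n x)\<bar> \<le> \<bar>\<Sum>i<2 ^ n. \<bar>u i\<bar>\<bar>"
      using member_le_sum[of "dyadic_index n x" "{..<2 ^ n}" "\<lambda>i. \<bar>u i\<bar>"] dyadic_index_less[OF that]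
      by (simp add: sum_nonneg)
    then show ?thesis
      by (simp add: abs_mult mult_left_mono)
  qed
  show ?thesis
    by (rule set_integrable_bound[OF dom meas]) (rule AE_I2, rule impI, rule le)
qed

definition cell_average :: "nat \<Rightarrow> (real \<Rightarrow> real) \<Rightarrow> nat \<Rightarrow> real" where
  "cell_average n f i = 2 ^ n * (LBINT t:dyadic_interval n i. f t)"

text \<open>Exchanging the sum with the integral turns the partial sum into the integral of \<open>f\<close> against the
  Dirichlet kernel.\<close>

lemma walsh_partial_sum_eq_average:
  assumes f: "set_integrable lborel {0..<1} f" and x: "x \<in> {0..<1}"
  shows "walsh_partial_sum (2 ^ n) f x = cell_average n f (dyadic_index n x)"
proof -
  let ?I = "dyadic_interval n (dyadic_index n x)"
  have int: "set_integrable lborel {0..<1} (\<lambda>t. f t * walsh k t * walsh k x)" if "k < 2 ^ n" for k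
  proof -
    have "set_integrable lborel {0..<1} (\<lambda>t. f t * walsh k t)
        \<longleftrightarrow> set_integrable lborel {0..<1} (\<lambda>t. f t * walsh k (real (dyadic_index n t) / 2 ^ n))"
      by (intro set_integrable_cong) (auto simp flip: walsh_at_left_endpoint[OF _ that])
    then show ?thesis
      using set_integrable_mult_step[OF f, of "\<lambda>i. walsh k (real i / 2 ^ n)" n] by simp
  qed
  have "walsh_partial_sum (2 ^ n) f x = (\<Sum>k<2 ^ n. LBINT t:{0..<1}. f t * walsh k t * walsh k x)"
    unfolding walsh_partial_sum_def walsh_coeff_def by simp
  also have "\<dots> = (LBINT t:{0..<1}. \<Sum>k<2 ^ n. f t * walsh k t * walsh k x)"
    unfolding set_lebesgue_integral_def scaleR_sum_right
    by (rule Bochner_Integration.integral_sum[symmetric]) (use int in \<open>simp add: set_integrable_def\<close>)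
  also have "\<dots> = (LBINT t:{0..<1}. 2 ^ n * (indicator ?I t * f t))"
  proof (rule set_lebesgue_integral_cong, simp, intro allI impI)
    fix t :: real assume t: "t \<in> {0..<1}"
    have "(\<Sum>k<2 ^ n. f t * walsh k t * walsh k x) = f t * (\<Sum>k<2 ^ n. walsh k x * walsh k t)"
      unfolding sum_distrib_left by (simp add: mult_ac)
    also have "\<dots> = 2 ^ n * (indicator ?I t * f t)"
    proof -
      have "t \<in> ?I \<longleftrightarrow> dyadic_index n x = dyadic_index n t"
        using dyadic_index_eq_iff[of t n "dyadic_index n x"] t by auto
      then show ?thesis
        unfolding walsh_dirichlet_kernel[OF x t] by (cases "t \<in> ?I") auto
    qed
    finally show "(\<Sum>k<2 ^ n. f t * walsh k t * walsh k x) = 2 ^ n * (indicator ?I t * f t)" .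
  qed
  also have "\<dots> = 2 ^ n * (LBINT t:?I. f t)"
  proof -
    have "indicator {0..<1} t *\<^sub>R (indicator ?I t * f t) = indicator ?I t *\<^sub>R f t" for t
      using dyadic_interval_subset[OF dyadic_index_less[OF x], of n] by (cases "t \<in> ?I") auto
    then have "(LBINT t:{0..<1}. indicator ?I t * f t) = (LBINT t:?I. f t)"
      unfolding set_lebesgue_integral_def by (simp only:)
    then show ?thesis
      by simp
  qed
  finally show ?thesis
    unfolding cell_average_def .
qed

section \<open>Averages of primitives of step functions\<close>

definition cell_midpoint :: "nat \<Rightarrow> nat \<Rightarrow> real" where
  "cell_midpoint n i = (real i + 1 / 2) / 2 ^ n"

lemma cell_average_affine:
  assumes "i < 2 ^ n" "\<And>s. s \<in> dyadic_interval n i \<Longrightarrow> f s = c + (s - a) * g"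
  shows "cell_average n f i = c + (cell_midpoint n i - a) * g"
proof -
  define l u where "l = real i / 2 ^ n" and "u = real (Suc i) / 2 ^ n"
  have lu: "l \<le> u" "u = l + 1 / 2 ^ n"
    unfolding l_def u_def by (simp_all add: field_simps)
  have "(LBINT s:dyadic_interval n i. f s) = (LBINT s:{l..<u}. c + (s - a) * g)"
    unfolding dyadic_interval_def l_def u_def
    by (rule set_lebesgue_integral_cong) (use assms(2) in \<open>auto simp: dyadic_interval_def\<close>)
  also have "\<dots> = (LBINT s=l..u. c + (s - a) * g)"
    using lu(1) by (simp add: interval_integral_Ico)
  also have "\<dots> = (c * u + (u - a)\<^sup>2 / 2 * g) - (c * l + (l - a)\<^sup>2 / 2 * g)"
  proof (rule interval_integral_FTC_finite)
    show "continuous_on {min l u..max l u} (\<lambda>s. c + (s - a) * g)"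
      by (intro continuous_intros)
    show "((\<lambda>s. c * s + (s - a)\<^sup>2 / 2 * g) has_vector_derivative c + (x - a) * g)
        (at x within {min l u..max l u})" for x
      unfolding has_real_derivative_iff_has_vector_derivative[symmetric]
      by (auto intro!: derivative_eq_intros)
  qed
  also have "\<dots> = (u - l) * (c + ((l + u) / 2 - a) * g)"
    by (simp add: power2_eq_square field_simps)
  finally have "cell_average n f i = c + ((l + u) / 2 - a) * g"
    unfolding cell_average_def using lu(2) by simp
  moreover have "(l + u) / 2 = cell_midpoint n i"
    unfolding l_def u_def cell_midpoint_def by (simp add: field_simps)
  ultimately show ?thesis
    by simp
qed

text \<open>The points \<open>a\<close> and \<open>b\<close> range over the closed cell, since an endpoint does not affect the integral.
  The right endpoint of one cell is the left endpoint of the next, and this is how neighbouring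
  cells are linked later.\<close>

lemma interval_integral_step_diff:
  fixes \<xi> a b :: real and G :: "nat \<Rightarrow> real"
  assumes "i < 2 ^ n" "\<xi> \<in> {0..<1}" "a \<in> {0..<1}" "b \<in> {0..<1}"
    and a: "a \<in> {real i / 2 ^ n..real (Suc i) / 2 ^ n}"
    and b: "b \<in> {real i / 2 ^ n..real (Suc i) / 2 ^ n}"
  shows "(LBINT t=\<xi>..b. G (dyadic_index n t)) = (LBINT t=\<xi>..a. G (dyadic_index n t)) + (b - a) * G i"
proof -
  have one: "set_integrable lborel {0..<1} (\<lambda>x::real. 1 :: real)"
    unfolding set_integrable_def by simp
  have "set_integrable lborel {0..<1} (\<lambda>t. G (dyadic_index n t))"
    using set_integrable_mult_step[OF one, of G n] by simp
  then have "set_integrable lborel {u<..<v} (\<lambda>t. G (dyadic_index n t))" if "u \<in> {0..<1}" "v \<in> {0..<1}" for u v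
    by (rule set_integrable_subset) (use that in auto)
  moreover have "min \<xi> (min a b) \<in> {0..<1}" "max \<xi> (max a b) \<in> {0..<1}"
    using assms(2-4) by (auto simp: min_def max_def)
  ultimately have "set_integrable lborel {min \<xi> (min a b)<..<max \<xi> (max a b)} (\<lambda>t. G (dyadic_index n t))"
    by blast
  moreover have min: "min (ereal \<xi>) (min (ereal a) (ereal b)) = ereal (min \<xi> (min a b))"
    and max: "max (ereal \<xi>) (max (ereal a) (ereal b)) = ereal (max \<xi> (max a b))"
    by (simp_all add: min_def max_def)
  ultimately have "interval_lebesgue_integrable lborel (min (ereal \<xi>) (min (ereal a) (ereal b)))
      (max (ereal \<xi>) (max (ereal a) (ereal b))) (\<lambda>t. G (dyadic_index n t))"
    unfolding interval_lebesgue_integrable_def min max by (simp del: ereal_min ereal_max)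
  then have "(LBINT t=\<xi>..a. G (dyadic_index n t)) + (LBINT t=a..b. G (dyadic_index n t))
      = (LBINT t=\<xi>..b. G (dyadic_index n t))"
    by (rule interval_integral_sum)
  moreover have "(LBINT t=a..b. G (dyadic_index n t)) = (LBINT t=a..b. G i)"
  proof (rule interval_integral_cong)
    fix t assume "t \<in> einterval (min (ereal a) (ereal b)) (max (ereal a) (ereal b))"
    then have "t \<in> {min a b<..<max a b}"
      by (auto simp: einterval_iff min_def max_def split: if_splits)
    then have "t \<in> dyadic_interval n i"
      using a b unfolding dyadic_interval_def by auto
    then show "G (dyadic_index n t) = G i"
      using dyadic_index_eqI[OF assms(1)] by simp
  qed
  ultimately show ?thesis
    by (simp add: mult.commute)
qed

text \<open>The base point \<open>a\<close> is free in the closed cell: it will be \<open>\<xi>\<close>, where \<open>F\<close> vanishes, or the common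
  endpoint of two neighbouring cells, where the value of \<open>F\<close> cancels in the difference of averages.\<close>

lemma cell_average_step_primitive:
  fixes \<xi> a :: real and F :: "real \<Rightarrow> real" and G :: "nat \<Rightarrow> real"
  assumes "i < 2 ^ n" "\<xi> \<in> {0..<1}" "a \<in> {0..<1}"
    and "a \<in> {real i / 2 ^ n..real (Suc i) / 2 ^ n}"
    and F: "\<And>s. s \<in> {0..<1} \<Longrightarrow> F s = (LBINT t=\<xi>..s. G (dyadic_index n t))"
  shows "cell_average n F i = F a + (cell_midpoint n i - a) * G i"
proof (rule cell_average_affine[OF assms(1)])
  fix s assume s: "s \<in> dyadic_interval n i"
  then have "s \<in> {0..<1}"
    using dyadic_interval_subset[OF assms(1)] by blast
  moreover have "s \<in> {real i / 2 ^ n..real (Suc i) / 2 ^ n}"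
    using s unfolding dyadic_interval_def by auto
  ultimately show "F s = F a + (s - a) * G i"
    using interval_integral_step_diff[OF assms(1,2,3) _ assms(4), of s G]
    unfolding F[OF \<open>s \<in> {0..<1}\<close>] F[OF assms(3)] by blast
qed

lemma set_integrable_step_primitive:
  fixes \<xi> :: real and F :: "real \<Rightarrow> real" and G :: "nat \<Rightarrow> real"
  assumes "\<xi> \<in> {0..<1}"
    and F: "\<And>s. s \<in> {0..<1} \<Longrightarrow> F s = (LBINT t=\<xi>..s. G (dyadic_index n t))"
  shows "set_integrable lborel {0..<1} F"
proof -
  let ?u = "\<lambda>i. F (real i / 2 ^ n) - real i / 2 ^ n * G i"
  have one: "set_integrable lborel {0..<1} (\<lambda>x::real. 1 :: real)"
    unfolding set_integrable_def by simp
  have "set_integrable lborel {0..1} (\<lambda>x::real. x)"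
    by (intro borel_integrable_atLeastAtMost') (rule continuous_on_id)
  then have id: "set_integrable lborel {0..<1} (\<lambda>x::real. x)"
    by (rule set_integrable_subset) auto
  have "set_integrable lborel {0..<1} (\<lambda>s. 1 * ?u (dyadic_index n s) + s * G (dyadic_index n s))"
    by (rule set_integral_add(1)[OF set_integrable_mult_step[OF one] set_integrable_mult_step[OF id]])
  moreover have "1 * ?u (dyadic_index n s) + s * G (dyadic_index n s) = F s" if s: "s \<in> {0..<1}" for s
  proof -
    let ?i = "dyadic_index n s"
    have i: "?i < 2 ^ n"
      by (rule dyadic_index_less[OF s])
    have "s \<in> {real ?i / 2 ^ n..real (Suc ?i) / 2 ^ n}"
      by (rule in_own_closed_cell[OF s])
    moreover have l: "real ?i / 2 ^ n \<in> {0..<1}"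
      by (rule left_endpoint_in_unit_interval[OF i])
    moreover have "real ?i / 2 ^ n \<in> {real ?i / 2 ^ n..real (Suc ?i) / 2 ^ n}"
      by (simp add: divide_right_mono)
    ultimately have "F s = F (real ?i / 2 ^ n) + (s - real ?i / 2 ^ n) * G ?i"
      using interval_integral_step_diff[OF i assms(1) l s, where G = G] F s by simp
    then show ?thesis
      by (simp add: algebra_simps)
  qed
  ultimately show ?thesis
    by (subst set_integrable_cong[OF refl refl]) auto
qed

section \<open>Two-term recurrences with a condition at one index\<close>

lemma eq_iff_eq_at_and_increments_eq:
  fixes Y Z :: "nat \<Rightarrow> 'a :: ab_group_add"
  assumes "m < N"
  shows "(\<forall>i<N. Y i = Z i) \<longleftrightarrow> Y m = Z m \<and> (\<forall>i. Suc i < N \<longrightarrow> Y (Suc i) - Y i = Z (Suc i) - Z i)"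
proof (intro iffI conjI)
  assume R: "Y m = Z m \<and> (\<forall>i. Suc i < N \<longrightarrow> Y (Suc i) - Y i = Z (Suc i) - Z i)"
  have W: "Y i - Z i = Y 0 - Z 0" if "i < N" for i
    using that
  proof (induction i)
    case (Suc i)
    then have "Y (Suc i) - Y i = Z (Suc i) - Z i"
      using R by blast
    then have "Y (Suc i) - Z (Suc i) = Y i - Z i"
      by (simp add: algebra_simps)
    then show ?case
      using Suc by simp
  qed simp
  show "\<forall>i<N. Y i = Z i"
    using W W[OF assms] R by (metis eq_iff_diff_eq_0)
qed (use assms in auto)

text \<open>The condition is imposed at an arbitrary index \<open>m\<close>, but the recurrence is solved from index 0 only:
  the \<open>i\<close>-th entry of a solution is an affine function \<open>\<alpha> i * t + \<beta> i\<close> of its initial value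
  \<open>t\<close>. The \<open>a i\<close> being nonzero allows the forward step; the \<open>b i\<close> being nonzero makes \<open>\<alpha> m\<close>
  nonzero, so that exactly one \<open>t\<close> gives the value \<open>v\<close> at \<open>m\<close>.\<close>

lemma two_term_recurrence_unique_solution:
  fixes a b e :: "nat \<Rightarrow> 'a :: field"
  assumes "m < N" and nz: "\<And>i. i < N \<Longrightarrow> a i \<noteq> 0" "\<And>i. i < N \<Longrightarrow> b i \<noteq> 0"
  shows "\<exists>Y. (Y m = v \<and> (\<forall>i. Suc i < N \<longrightarrow> a (Suc i) * Y (Suc i) = b i * Y i + e i)) \<and>
    (\<forall>Z. (Z m = v \<and> (\<forall>i. Suc i < N \<longrightarrow> a (Suc i) * Z (Suc i) = b i * Z i + e i))
      \<longrightarrow> (\<forall>i<N. Z i = Y i))"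
proof -
  define \<alpha> where "\<alpha> = rec_nat 1 (\<lambda>i r. b i * r / a (Suc i))"
  define \<beta> where "\<beta> = rec_nat 0 (\<lambda>i r. (b i * r + e i) / a (Suc i))"
  have \<alpha>: "\<alpha> 0 = 1" "\<alpha> (Suc i) = b i * \<alpha> i / a (Suc i)" for i
    unfolding \<alpha>_def by simp_all
  have \<beta>: "\<beta> 0 = 0" "\<beta> (Suc i) = (b i * \<beta> i + e i) / a (Suc i)" for i
    unfolding \<beta>_def by simp_all
  have gen: "Z i = \<alpha> i * Z 0 + \<beta> i"
    if Z: "\<And>i. Suc i < N \<Longrightarrow> a (Suc i) * Z (Suc i) = b i * Z i + e i" and "i < N" for Z i
    using \<open>i < N\<close>
  proof (induction i)
    case (Suc i)
    then have "Z (Suc i) = (b i * Z i + e i) / a (Suc i)"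
      using Z[of i] nz(1)[of "Suc i"] by (simp add: field_simps)
    then show ?case
      using Suc by (simp add: \<alpha> \<beta> algebra_simps add_divide_distrib)
  qed (simp add: \<alpha> \<beta>)
  have "\<alpha> i \<noteq> 0" if "i < N" for i
    using that by (induction i) (auto simp: \<alpha> nz)
  then have \<alpha>m: "\<alpha> m \<noteq> 0"
    using assms(1) by blast
  define Y where "Y i = \<alpha> i * ((v - \<beta> m) / \<alpha> m) + \<beta> i" for i
  show ?thesis
  proof (intro exI[of _ Y] conjI allI impI)
    show "Y m = v"
      unfolding Y_def using \<alpha>m by simp
    show "a (Suc i) * Y (Suc i) = b i * Y i + e i" if "Suc i < N" for i
    proof -
      have "Y (Suc i) = (b i * Y i + e i) / a (Suc i)"
        unfolding Y_def \<alpha> \<beta> by (simp add: algebra_simps add_divide_distrib)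
      then show ?thesis
        using nz(1)[OF that] by simp
    qed
    fix Z i
    assume Z: "Z m = v \<and> (\<forall>i. Suc i < N \<longrightarrow> a (Suc i) * Z (Suc i) = b i * Z i + e i)" and i: "i < N"
    have gen_Z: "Z j = \<alpha> j * Z 0 + \<beta> j" if "j < N" for j
      using gen[of Z j] Z that by blast
    then have "v = \<alpha> m * Z 0 + \<beta> m"
      using assms(1) Z by metis
    then have "Z 0 = (v - \<beta> m) / \<alpha> m"
      using \<alpha>m by (simp add: field_simps)
    then show "Z i = Y i"
      using gen_Z[OF i] unfolding Y_def by simp
  qed
qed

section \<open>Small integrals over small cells\<close>

text \<open>The integral over a cell is an increment of the indefinite integral, which is continuous on the
  compact interval from 0 to 1 and therefore uniformly continuous.\<close>

lemma integral_dyadic_interval_uniformly_small: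
  assumes p: "set_integrable lborel {0..<1} (p :: real \<Rightarrow> real)" and "\<epsilon> > 0"
  obtains N where "\<And>n i. N \<le> n \<Longrightarrow> i < 2 ^ n \<Longrightarrow> \<bar>LBINT t:dyadic_interval n i. p t\<bar> < \<epsilon>"
proof -
  \<comment> \<open>Extension by 0 makes the closed interval available, where compactness holds.\<close>
  define f where "f x = indicator {0..<1} x * p x" for x
  have f: "set_integrable lborel S f" if "S \<in> sets borel" for S
  proof -
    have "set_integrable lborel UNIV f"
      using p unfolding set_integrable_def f_def by simp
    then show ?thesis
      by (rule set_integrable_subset) (use that in auto)
  qed
  have int: "f integrable_on {a..b}" for a b
    by (rule set_borel_integral_eq_integral(1)[OF f]) simp
  have "uniformly_continuous_on {0..1} (\<lambda>x. integral {0..x} f)"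
    by (intro compact_uniformly_continuous indefinite_integral_continuous_1 int compact_Icc)
  then obtain d where "d > 0" and d: "\<And>x y. x \<in> {0..1} \<Longrightarrow> y \<in> {0..1} \<Longrightarrow> dist y x < d
      \<Longrightarrow> dist (integral {0..y} f) (integral {0..x} f) < \<epsilon>"
    using \<open>\<epsilon> > 0\<close> unfolding uniformly_continuous_on_def by metis
  obtain N where N: "(1 / 2) ^ N < d"
    using real_arch_pow_inv[OF \<open>d > 0\<close>, of "1 / 2"] by auto
  show thesis
  proof (rule that)
    fix n i :: nat assume "N \<le> n" and i: "i < 2 ^ n"
    define l u where "l = real i / 2 ^ n" and "u = real (Suc i) / 2 ^ n"
    have "real (Suc i) \<le> 2 ^ n"
      using i by (metis Suc_leI of_nat_le_iff of_nat_numeral of_nat_power)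
    then have lu: "0 \<le> l" "l \<le> u" "u \<le> 1"
      unfolding l_def u_def by (simp_all add: divide_right_mono)
    have "u - l = (1 / 2) ^ n"
      unfolding l_def u_def by (simp add: field_simps power_divide)
    also have "\<dots> \<le> (1 / 2) ^ N"
      using \<open>N \<le> n\<close> by (intro power_decreasing) auto
    finally have "dist u l < d"
      using N lu by (simp add: dist_real_def)
    then have "\<bar>integral {0..u} f - integral {0..l} f\<bar> < \<epsilon>"
      using d[of l u] lu by (simp add: dist_real_def)
    moreover have "integral {0..l} f + integral {l..u} f = integral {0..u} f"
      by (rule Henstock_Kurzweil_Integration.integral_combine) (use lu int in auto)
    moreover have "(LBINT t:dyadic_interval n i. p t) = integral {l..u} f"
    proof -
      have "(LBINT t:dyadic_interval n i. p t) = (LBINT t:{l..<u}. f t)"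
        unfolding dyadic_interval_def l_def u_def
        by (rule set_lebesgue_integral_cong)
           (use dyadic_interval_subset[OF i] in \<open>auto simp: f_def dyadic_interval_def subset_iff\<close>)
      also have "\<dots> = (LBINT t=l..u. f t)"
        using lu(2) by (simp add: interval_integral_Ico)
      also have "\<dots> = (LBINT t:{l..u}. f t)"
        using lu(2) by (simp add: interval_integral_Icc)
      also have "\<dots> = integral {l..u} f"
        by (rule set_borel_integral_eq_integral(2)[OF f]) simp
      finally show ?thesis .
    qed
    ultimately show "\<bar>LBINT t:dyadic_interval n i. p t\<bar> < \<epsilon>"
      by linarith
  qed
qed

section \<open>The discretized equation as a recurrence\<close>

text \<open>On cells the equation reads \<open>Y i = \<eta> + A i\<close> with \<open>A i\<close> the average of the primitive \<open>F\<close> over cell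
  \<open>i\<close>. Each \<open>A i\<close> involves all values of \<open>Y\<close> between cell \<open>i\<close> and the cell of \<open>\<xi>\<close>. Comparing increments
  instead of entries leaves only two neighbouring values in each equation; the one remaining
  equation is taken at the cell of \<open>\<xi>\<close>, where \<open>A m\<close> involves \<open>Y m\<close> alone.\<close>

lemma discretized_solution_step_iff:
  fixes \<xi> \<eta> :: real and p q :: "real \<Rightarrow> real" and n :: nat
  assumes \<xi>: "\<xi> \<in> {0..<1}"
    and p: "set_integrable lborel {0..<1} p" and q: "set_integrable lborel {0..<1} q"
  defines "P \<equiv> cell_average n p" and "Q \<equiv> cell_average n q" and "m \<equiv> dyadic_index n \<xi>"
  shows "discretized_solution \<xi> \<eta> p q n (\<lambda>x\<in>{0..<1}. Y (dyadic_index n x)) \<longleftrightarrow>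
    Y m = \<eta> + (cell_midpoint n m - \<xi>) * (Q m - P m * Y m) \<and>
    (\<forall>i. Suc i < 2 ^ n \<longrightarrow>
      Y (Suc i) - Y i = ((Q i - P i * Y i) + (Q (Suc i) - P (Suc i) * Y (Suc i))) / 2 ^ Suc n)"
proof -
  define y where "y = (\<lambda>x\<in>{0..<1}. Y (dyadic_index n x))"
  define g where "g i = Q i - P i * Y i" for i
  define F where "F s = (LBINT t=\<xi>..s. walsh_partial_sum (2 ^ n) q t - walsh_partial_sum (2 ^ n) p t * y t)" for s :: real
  have F: "F s = (LBINT t=\<xi>..s. g (dyadic_index n t))" if s: "s \<in> {0..<1}" for s
    unfolding F_def
  proof (rule interval_integral_cong)
    fix t assume "t \<in> einterval (min (ereal \<xi>) (ereal s)) (max (ereal \<xi>) (ereal s))"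
    then have t: "t \<in> {0..<1}"
      using \<xi> s by (auto simp: einterval_iff min_def max_def split: if_splits)
    show "walsh_partial_sum (2 ^ n) q t - walsh_partial_sum (2 ^ n) p t * y t = g (dyadic_index n t)"
      unfolding walsh_partial_sum_eq_average[OF p t] walsh_partial_sum_eq_average[OF q t]
      using t by (simp add: g_def P_def Q_def y_def)
  qed
  have F_int: "set_integrable lborel {0..<1} F"
    by (rule set_integrable_step_primitive[OF \<xi> F])
  define A where "A = cell_average n F"
  have "discretized_solution \<xi> \<eta> p q n y \<longleftrightarrow> (\<forall>x\<in>{0..<1}. y x = \<eta> + walsh_partial_sum (2 ^ n) F x)"
    unfolding discretized_solution_def F_def ..
  also have "\<dots> \<longleftrightarrow> (\<forall>x\<in>{0..<1}. Y (dyadic_index n x) = \<eta> + A (dyadic_index n x))"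
    by (intro ball_cong refl) (simp add: y_def A_def walsh_partial_sum_eq_average[OF F_int])
  also have "\<dots> \<longleftrightarrow> (\<forall>i<2 ^ n. Y i = \<eta> + A i)"
  proof (intro iffI allI impI ballI)
    fix i :: nat
    assume R: "\<forall>x\<in>{0..<1}. Y (dyadic_index n x) = \<eta> + A (dyadic_index n x)" and i: "i < 2 ^ n"
    have "real i / 2 ^ n \<in> {0..<1}"
      by (rule left_endpoint_in_unit_interval[OF i])
    then show "Y i = \<eta> + A i"
      using R dyadic_index_left_endpoint[OF i] by metis
  qed (use dyadic_index_less in blast)
  also have "\<dots> \<longleftrightarrow> Y m = \<eta> + A m \<and> (\<forall>i. Suc i < 2 ^ n \<longrightarrow> Y (Suc i) - Y i = (\<eta> + A (Suc i)) - (\<eta> + A i))"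
    unfolding m_def by (rule eq_iff_eq_at_and_increments_eq[OF dyadic_index_less[OF \<xi>]])
  also have "A m = (cell_midpoint n m - \<xi>) * g m"
  proof -
    have "\<xi> \<in> {real m / 2 ^ n..real (Suc m) / 2 ^ n}"
      unfolding m_def by (rule in_own_closed_cell[OF \<xi>])
    moreover have "m < 2 ^ n"
      unfolding m_def by (rule dyadic_index_less[OF \<xi>])
    ultimately have "A m = F \<xi> + (cell_midpoint n m - \<xi>) * g m"
      unfolding A_def using cell_average_step_primitive[OF _ \<xi> \<xi> _ F] by blast
    then show ?thesis
      by (simp add: F_def)
  qed
  also have "(\<forall>i. Suc i < 2 ^ n \<longrightarrow> Y (Suc i) - Y i = (\<eta> + A (Suc i)) - (\<eta> + A i))
      \<longleftrightarrow> (\<forall>i. Suc i < 2 ^ n \<longrightarrow> Y (Suc i) - Y i = (g i + g (Suc i)) / 2 ^ Suc n)"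
  proof -
    have "A (Suc i) - A i = (g i + g (Suc i)) / 2 ^ Suc n" if i: "Suc i < 2 ^ n" for i
    proof -
      let ?a = "real (Suc i) / 2 ^ n"
      have a: "?a \<in> {0..<1}"
        by (rule left_endpoint_in_unit_interval[OF i])
      have "A i = F ?a + (cell_midpoint n i - ?a) * g i"
        unfolding A_def by (rule cell_average_step_primitive[OF _ \<xi> a _ F]) (use i in \<open>simp_all add: divide_right_mono\<close>)
      moreover have "A (Suc i) = F ?a + (cell_midpoint n (Suc i) - ?a) * g (Suc i)"
        unfolding A_def by (rule cell_average_step_primitive[OF i \<xi> a _ F]) (simp_all add: divide_right_mono)
      moreover have "cell_midpoint n i - ?a = - 1 / 2 ^ Suc n" "cell_midpoint n (Suc i) - ?a = 1 / 2 ^ Suc n"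
        unfolding cell_midpoint_def by (simp_all add: field_simps)
      ultimately show ?thesis
        by (simp add: add_divide_distrib)
    qed
    then show ?thesis
      by simp
  qed
  finally show ?thesis
    unfolding y_def g_def .
qed

theorem theorem4p2:
  fixes \<xi> \<eta> :: real and p q :: "real \<Rightarrow> real"
  assumes "\<xi> \<in> {0..<1}"
    and "continuous_on {0..<1} p" and "continuous_on {0..<1} q"
    and "set_integrable lborel {0..<1} p" and "set_integrable lborel {0..<1} q"
  shows "\<exists>N::nat. \<forall>n\<ge>N. \<exists>!y. y \<in> walsh_polynomials (2 ^ n) \<and> discretized_solution \<xi> \<eta> p q n y"
proof -
  obtain N where N: "\<And>n i. N \<le> n \<Longrightarrow> i < 2 ^ n \<Longrightarrow> \<bar>LBINT t:dyadic_interval n i. p t\<bar> < 2"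
    using integral_dyadic_interval_uniformly_small[OF assms(4), of 2] by auto
  have "\<exists>!y. y \<in> walsh_polynomials (2 ^ n) \<and> discretized_solution \<xi> \<eta> p q n y" if "N \<le> n" for n
  proof -
    define P Q m where "P = cell_average n p" and "Q = cell_average n q" and "m = dyadic_index n \<xi>"
    define \<delta> where "\<delta> = cell_midpoint n m - \<xi>"
    define a b e where "a i = 1 + P i / 2 ^ Suc n" and "b i = 1 - P i / 2 ^ Suc n"
      and "e i = (Q i + Q (Suc i)) / 2 ^ Suc n" for i
    have m: "m < 2 ^ n"
      unfolding m_def by (rule dyadic_index_less[OF assms(1)])
    \<comment> \<open>This fraction is half the integral of \<open>p\<close> over cell \<open>i\<close>, hence the bound 2 in the choice of \<open>N\<close>.\<close>
    have small: "\<bar>P i / 2 ^ Suc n\<bar> < 1" if "i < 2 ^ n" for i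
      using N[OF \<open>N \<le> n\<close> that] by (simp add: P_def cell_average_def abs_mult)
    have a: "a i \<noteq> 0" and b: "b i \<noteq> 0" if "i < 2 ^ n" for i
      using small[OF that] unfolding a_def b_def by linarith+
    have \<delta>: "\<bar>\<delta>\<bar> \<le> 1 / 2 ^ Suc n"
    proof -
      have "real m / 2 ^ n \<le> \<xi>" "\<xi> \<le> real m / 2 ^ n + 2 * (1 / 2 ^ Suc n)"
        using in_own_closed_cell[OF assms(1), of n] unfolding m_def by (simp_all add: add_divide_distrib)
      moreover have "\<delta> = real m / 2 ^ n + 1 / 2 ^ Suc n - \<xi>"
        unfolding \<delta>_def cell_midpoint_def by (simp add: add_divide_distrib)
      ultimately show ?thesis
        by linarith
    qed
    have "\<bar>\<delta> * P m\<bar> \<le> 1 / 2 ^ Suc n * \<bar>P m\<bar>"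
      unfolding abs_mult by (rule mult_right_mono[OF \<delta>]) simp
    also have "\<dots> < 1"
      using small[OF m] by simp
    finally have c: "1 + \<delta> * P m \<noteq> 0"
      by linarith
    define v where "v = (\<eta> + \<delta> * Q m) / (1 + \<delta> * P m)"
    have solution_iff: "discretized_solution \<xi> \<eta> p q n (\<lambda>x\<in>{0..<1}. Y (dyadic_index n x)) \<longleftrightarrow>
        Y m = v \<and> (\<forall>i. Suc i < 2 ^ n \<longrightarrow> a (Suc i) * Y (Suc i) = b i * Y i + e i)" for Y
    proof -
      have "Y m = \<eta> + \<delta> * (Q m - P m * Y m) \<longleftrightarrow> (1 + \<delta> * P m) * Y m = \<eta> + \<delta> * Q m"
        by (auto simp: algebra_simps)
      also have "\<dots> \<longleftrightarrow> Y m = v"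
        unfolding v_def using c by (auto simp: nonzero_eq_divide_eq mult.commute)
      finally have 1: "Y m = \<eta> + \<delta> * (Q m - P m * Y m) \<longleftrightarrow> Y m = v" .
      have 2: "Y (Suc i) - Y i = ((Q i - P i * Y i) + (Q (Suc i) - P (Suc i) * Y (Suc i))) / 2 ^ Suc n
          \<longleftrightarrow> a (Suc i) * Y (Suc i) = b i * Y i + e i" for i
      proof -
        \<comment> \<open>With the division hidden in \<open>h\<close>, both equations are polynomial and differ by a rearrangement of terms.\<close>
        define h :: real where "h = 1 / 2 ^ Suc n"
        have "x / 2 ^ Suc n = h * x" for x :: real
          unfolding h_def by simp
        then show ?thesis
          unfolding a_def b_def e_def by (auto simp only: algebra_simps)
      qed
      show ?thesis
        unfolding discretized_solution_step_iff[OF assms(1,4,5)] 1[symmetric] 2[symmetric]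
        unfolding P_def Q_def m_def \<delta>_def ..
    qed
    obtain Y where Y: "Y m = v \<and> (\<forall>i. Suc i < 2 ^ n \<longrightarrow> a (Suc i) * Y (Suc i) = b i * Y i + e i)"
      and uniq: "\<And>Z. Z m = v \<and> (\<forall>i. Suc i < 2 ^ n \<longrightarrow> a (Suc i) * Z (Suc i) = b i * Z i + e i)
        \<Longrightarrow> \<forall>i<2 ^ n. Z i = Y i"
      using two_term_recurrence_unique_solution[where a = a and b = b and v = v and e = e, OF m a b] by blast
    show ?thesis
    proof (rule ex1I[of _ "\<lambda>x\<in>{0..<1}. Y (dyadic_index n x)"])
      show "(\<lambda>x\<in>{0..<1}. Y (dyadic_index n x)) \<in> walsh_polynomials (2 ^ n) \<and>
          discretized_solution \<xi> \<eta> p q n (\<lambda>x\<in>{0..<1}. Y (dyadic_index n x))"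
        using Y unfolding solution_iff walsh_polynomials_eq_step_functions by blast
      fix y
      assume y: "y \<in> walsh_polynomials (2 ^ n) \<and> discretized_solution \<xi> \<eta> p q n y"
      then obtain Z where Z: "y = (\<lambda>x\<in>{0..<1}. Z (dyadic_index n x))"
        unfolding walsh_polynomials_eq_step_functions by blast
      have "\<forall>i<2 ^ n. Z i = Y i"
        by (rule uniq) (use y in \<open>unfold Z solution_iff, blast\<close>)
      then show "y = (\<lambda>x\<in>{0..<1}. Y (dyadic_index n x))"
        unfolding Z by (intro restrict_ext) (simp add: dyadic_index_less)
    qed
  qed
  then show ?thesis
    by blast
qed

end
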